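(* Let $n$ be a positive integer and let $A,B$ be $n\times n$ complex strictly contractive matrices. Then $$\left|\det(I-A^*B)\right|^2\ \ge\ \det(I-A^*A)\det(I-B^*B)+\left|\det(A-B)\right|^2+(2^n-2)\big[\det(I-A^*A)\det(I-B^*B)\big]^{\frac12}\left|\det(A-B)\right|.$$
   Context: $X^*$ is the conjugate transpose of $X$, and $I$ is the $n\times n$ identity matrix. A matrix $A\in\mathbb{C}^{n\times n}$ is strictly contractive if $I-A^*A$ is positive definite, equivalently its largest singular value is $<1$. *)

theory Defs
  imports "Jordan_Normal_Form.Schur_Decomposition"
begin

(* mat_adjoint is the conjugate transpose, and (M *v x) \<bullet>c x is x* M x.  The order on complex
   is the one of HOL-Library.Complex_Order: 0 < z means that z is real and positive. *)

definition positive_definite :: "complex mat \<Rightarrow> bool" where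
  "positive_definite M \<longleftrightarrow> square_mat M \<and> mat_adjoint M = M \<and>
     (\<forall>x \<in> carrier_vec (dim_row M). x \<noteq> 0\<^sub>v (dim_row M) \<longrightarrow> 0 < (M *\<^sub>v x) \<bullet>c x)"

definition strictly_contractive :: "nat \<Rightarrow> complex mat \<Rightarrow> bool" where
  "strictly_contractive n A \<longleftrightarrow> A \<in> carrier_mat n n \<and>
     positive_definite (1\<^sub>m n - mat_adjoint A * A)"

lemma mat_adjoint_conjugate_transpose:
  fixes A :: "complex mat"
  shows "mat_adjoint A = map_mat cnj (transpose_mat A)"
  by (rule eq_matI) (auto simp: mat_adjoint_def mat_of_rows_index)

(* The determinant of a Hermitian matrix is real, so taking Re of it loses nothing. *)

lemma det_positive_definite_real:
  assumes "positive_definite M"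
  shows "complex_of_real (Re (det M)) = det M"
proof -
  have sq: "M \<in> carrier_mat (dim_row M) (dim_row M)"
    using assms by (auto simp: positive_definite_def)
  interpret cnj_hom: comm_ring_hom cnj
    by unfold_locales auto
  have "det M = det (map_mat cnj (transpose_mat M))"
    using assms by (simp add: positive_definite_def flip: mat_adjoint_conjugate_transpose)
  also have "\<dots> = cnj (det M)"
    using det_transpose[OF sq] by (simp add: cnj_hom.hom_det)
  finally show ?thesis
    by (metis Reals_cnj_iff of_real_Re)
qed

end

theory Submission
  imports Defs
begin

text \<open>
  Put \<open>C = I - A\<^sup>*A\<close>, \<open>P = I - B\<^sup>*B\<close> and \<open>Q = (A - B)\<^sup>* (I + A C\<^sup>-\<^sup>1 A\<^sup>*) (A - B)\<close>. Hua's identity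
  \<open>P + Q = (I - B\<^sup>*A) C\<^sup>-\<^sup>1 (I - A\<^sup>*B)\<close> and Sylvester's determinant identity turn the claim into
  \<open>det (P + Q) \<ge> det P + det Q + (2 ^ n - 2) sqrt (det P det Q)\<close> for \<open>P\<close> positive definite and \<open>Q\<close>
  positive semidefinite. Dividing by \<open>det P\<close>, this concerns the nonnegative eigenvalues \<open>x\<^sub>i\<close> of
  \<open>P\<^sup>-\<^sup>1 Q\<close>: in the expansion of \<open>\<Prod> (1 + x\<^sub>i)\<close>, AM-GM applies to each pair of complementary
  subproducts.
\<close>

section \<open>The scalar inequality for products of \<open>1 + x\<close>\<close>

text \<open>Induction over the list, multiplying the bound for the tail by \<open>1 + x\<close>.
  Starting from singletons matches the coefficient \<open>2 ^ length xs - 2\<close>, which vanishes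
  there.\<close>

lemma prod_list_one_plus_ge:
  fixes xs :: "real list"
  assumes "\<And>x. x \<in> set xs \<Longrightarrow> 0 \<le> x" and "xs \<noteq> []"
  shows "1 + prod_list xs + (2 ^ length xs - 2) * sqrt (prod_list xs) \<le> (\<Prod>x\<leftarrow>xs. 1 + x)"
  using assms(2,1)
proof (induction xs rule: list_nonempty_induct)
  case (single x)
  then show ?case by simp
next
  case (cons x xs)
  define L where "L = prod_list xs"
  define k :: real where "k = 2 ^ length xs - 2"
  have x: "0 \<le> x" and L: "0 \<le> L"
    using cons.prems by (auto simp: L_def intro!: prod_list_nonneg)
  \<comment> \<open>The tail is nonempty, so \<open>k\<close> is nonnegative and may multiply the
    AM-GM bound for \<open>1\<close> and \<open>x\<close>.\<close>
  have "(2::real) ^ 1 \<le> 2 ^ length xs"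
    using cons.hyps by (intro power_increasing) (auto simp: Suc_le_eq)
  then have k: "0 \<le> k" by (simp add: k_def)
  have am_gm: "2 * sqrt (x * L) \<le> x + L"
    using arith_geo_mean_sqrt[OF x L] by simp
  have "2 * sqrt x \<le> 1 + x"
    using arith_geo_mean_sqrt[OF x, of 1] by simp
  then have "k * sqrt L * (2 * sqrt x) \<le> k * sqrt L * (1 + x)"
    using k L by (intro mult_left_mono) auto
  \<comment> \<open>Expanding the right side, \<open>x + L\<close> yields 2 copies of
    \<open>sqrt (x * L)\<close> and \<open>k * sqrt L * (1 + x)\<close> yields \<open>2 * k\<close>.
    The sum \<open>2 * k + 2\<close> is the coefficient for a list longer by one.\<close>
  then have "1 + x * L + (2 * k + 2) * sqrt (x * L) \<le> (1 + x) * (1 + L + k * sqrt L)"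
    using am_gm by (simp add: real_sqrt_mult algebra_simps)
  also have "\<dots> \<le> (1 + x) * (\<Prod>x\<leftarrow>xs. 1 + x)"
    using cons x by (intro mult_left_mono) (auto simp: L_def k_def)
  finally show ?case
    by (simp add: L_def k_def)
qed

section \<open>Algebra of the conjugate transpose\<close>

lemma mat_adjoint_dim [simp]:
  fixes A :: "complex mat"
  shows "dim_row (mat_adjoint A) = dim_col A" and "dim_col (mat_adjoint A) = dim_row A"
  by (simp_all add: mat_adjoint_conjugate_transpose)

lemma mat_adjoint_carrier [simp]:
  fixes A :: "complex mat"
  shows "A \<in> carrier_mat n m \<Longrightarrow> mat_adjoint A \<in> carrier_mat m n"
  by (auto simp: mat_adjoint_conjugate_transpose)

lemma mat_adjoint_mult:
  fixes A B :: "complex mat"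
  assumes "A \<in> carrier_mat n m" and "B \<in> carrier_mat m k"
  shows "mat_adjoint (A * B) = mat_adjoint B * mat_adjoint A"
proof -
  interpret cnj_hom: comm_ring_hom cnj
    by unfold_locales auto
  show ?thesis
    using assms
    by (simp add: mat_adjoint_conjugate_transpose transpose_mult[OF assms] cnj_hom.mat_hom_mult[of _ k m _ n])
qed

lemma mat_adjoint_minus:
  fixes A B :: "complex mat"
  assumes "A \<in> carrier_mat n m" and "B \<in> carrier_mat n m"
  shows "mat_adjoint (A - B) = mat_adjoint A - mat_adjoint B"
  using assms by (intro eq_matI) (auto simp: mat_adjoint_conjugate_transpose)

lemma mat_adjoint_one [simp]: "mat_adjoint (1\<^sub>m n :: complex mat) = 1\<^sub>m n"
  by (intro eq_matI) (auto simp: mat_adjoint_conjugate_transpose)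

lemma mat_adjoint_adjoint [simp]: "mat_adjoint (mat_adjoint A) = (A :: complex mat)"
  by (intro eq_matI) (auto simp: mat_adjoint_conjugate_transpose)

lemma det_mat_adjoint:
  fixes A :: "complex mat"
  assumes "A \<in> carrier_mat n n"
  shows "det (mat_adjoint A) = cnj (det A)"
proof -
  interpret cnj_hom: comm_ring_hom cnj
    by unfold_locales auto
  show ?thesis
    using det_transpose[OF assms] by (simp add: mat_adjoint_conjugate_transpose cnj_hom.hom_det)
qed

lemma cscalar_prod_mat_adjoint:
  fixes A :: "complex mat"
  assumes "A \<in> carrier_mat n m" and "x \<in> carrier_vec m" and "y \<in> carrier_vec n"
  shows "(A *\<^sub>v x) \<bullet>c y = x \<bullet>c (mat_adjoint A *\<^sub>v y)"
proof -
  have "conjugate (mat_adjoint A *\<^sub>v y) = transpose_mat A *\<^sub>v conjugate y"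
    using assms
    by (intro eq_vecI)
      (auto simp: mat_adjoint_conjugate_transpose scalar_prod_def intro!: sum.cong)
  moreover have "x \<bullet> (transpose_mat A *\<^sub>v conjugate y) = (transpose_mat A *\<^sub>v conjugate y) \<bullet> x"
    using assms by (intro comm_scalar_prod[of _ m]) auto
  moreover have "(transpose_mat A *\<^sub>v conjugate y) \<bullet> x = conjugate y \<bullet> (A *\<^sub>v x)"
    using assms by (intro transpose_vec_mult_scalar[of _ n m]) auto
  moreover have "conjugate y \<bullet> (A *\<^sub>v x) = (A *\<^sub>v x) \<bullet> conjugate y"
    using assms by (intro comm_scalar_prod[of _ n]) auto
  ultimately show ?thesis by simp
qed

section \<open>Sylvester's determinant identity and determinants from eigenvalues\<close>

text \<open>Conjugation by the block swap \<open>J\<close> turns \<open>M\<close> into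
  \<open>N\<close>, so their determinants agree. The block determinant formula evaluates these to
  the two sides. No inverse is taken, so any integral domain will do.\<close>

lemma det_one_plus_mult_commute:
  fixes X Y :: "'a :: idom mat"
  assumes X: "X \<in> carrier_mat n n" and Y: "Y \<in> carrier_mat n n"
  shows "det (1\<^sub>m n + X * Y) = det (1\<^sub>m n + Y * X)"
proof -
  define J :: "'a mat" where "J = four_block_mat (0\<^sub>m n n) (1\<^sub>m n) (1\<^sub>m n) (0\<^sub>m n n)"
  define M where "M = four_block_mat (1\<^sub>m n) (- X) Y (1\<^sub>m n)"
  define N where "N = four_block_mat (1\<^sub>m n) Y (- X) (1\<^sub>m n)"
  have carrier: "J \<in> carrier_mat (n + n) (n + n)" "M \<in> carrier_mat (n + n) (n + n)"
    "N \<in> carrier_mat (n + n) (n + n)"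
    using X Y by (auto simp: J_def M_def N_def)
  have JJ: "J * J = 1\<^sub>m (n + n)"
    unfolding J_def by (subst mult_four_block_mat[of _ n n]) auto
  have JM: "J * M = four_block_mat Y (1\<^sub>m n) (1\<^sub>m n) (- X)"
    unfolding J_def M_def using X Y by (subst mult_four_block_mat[of _ n n _ n _ n]) auto
  have NJ: "N * J = four_block_mat Y (1\<^sub>m n) (1\<^sub>m n) (- X)"
    unfolding J_def N_def using X Y by (subst mult_four_block_mat[of _ n n _ n _ n]) auto
  have "det J * det M = det N * det J"
    using JM NJ det_mult[OF carrier(1,2)] det_mult[OF carrier(3,1)] by simp
  moreover have "det J * det J = 1"
    using det_mult[OF carrier(1,1)] JJ by simp
  ultimately have "det M = det N"
    by (metis mult.commute mult_cancel_left mult_zero_left zero_neq_one)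
  moreover have "det M = det (1\<^sub>m n * 1\<^sub>m n - (- X) * Y)"
    unfolding M_def using X Y by (intro det_four_block_mat) auto
  moreover have "1\<^sub>m n * 1\<^sub>m n - (- X) * Y = 1\<^sub>m n + X * Y"
    using X Y by (intro eq_matI) auto
  moreover have "det N = det (1\<^sub>m n * 1\<^sub>m n - Y * (- X))"
    unfolding N_def using X Y by (intro det_four_block_mat) auto
  moreover have "1\<^sub>m n * 1\<^sub>m n - Y * (- X) = 1\<^sub>m n + Y * X"
    using X Y by (intro eq_matI) auto
  ultimately show ?thesis by simp
qed

text \<open>The characteristic polynomial of \<open>- M\<close> at \<open>x\<close> is the
  determinant of \<open>x\<close> times the identity plus \<open>M\<close>. Its values at 0 and 1
  give both determinants without a sign \<open>(-1) ^ n\<close>; the eigenvalues are its negated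
  roots.\<close>

lemma det_eigenvalue_list:
  fixes M :: "complex mat"
  assumes M: "M \<in> carrier_mat n n"
  obtains es where "length es = n" and "\<And>e. e \<in> set es \<Longrightarrow> eigenvalue M e"
    and "det M = prod_list es" and "det (1\<^sub>m n + M) = (\<Prod>e\<leftarrow>es. 1 + e)"
proof -
  have mM: "- M \<in> carrier_mat n n" using M by simp
  obtain as where as: "char_poly (- M) = (\<Prod>a\<leftarrow>as. [:- a, 1:])" "length as = n"
    using char_poly_factorized[OF mM] by blast
  have poly: "poly (char_poly (- M)) x = (\<Prod>a\<leftarrow>as. x - a)" for x
    by (simp add: as poly_prod_list o_def)
  have "- char_matrix (- M) 0 = M" "- char_matrix (- M) 1 = 1\<^sub>m n + M"
    using M by (auto simp: char_matrix_def intro!: eq_matI)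
  then have dets: "det M = prod_list (map uminus as)"
    "det (1\<^sub>m n + M) = (\<Prod>e\<leftarrow>map uminus as. 1 + e)"
    using poly[of 0] poly[of 1] char_poly_matrix[OF mM, of 0] char_poly_matrix[OF mM, of 1]
    by (simp_all add: o_def)
  have "eigenvalue M (- a)" if "a \<in> set as" for a
  proof -
    have "poly (char_poly (- M)) a = 0"
      using that by (simp add: poly prod_list_zero_iff image_iff)
    then obtain v where v: "v \<in> carrier_vec n" "v \<noteq> 0\<^sub>v n" "- M *\<^sub>v v = a \<cdot>\<^sub>v v"
      using M by (auto simp: eigenvalue_root_char_poly[OF mM, symmetric] eigenvalue_def eigenvector_def)
    have "M *\<^sub>v v = - (- M *\<^sub>v v)"
      using M v(1) by auto
    also have "\<dots> = (- a) \<cdot>\<^sub>v v"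
      unfolding v(3) by auto
    finally show ?thesis
      using M v by (auto simp: eigenvalue_def eigenvector_def)
  qed
  with as(2) dets show ?thesis
    by (intro that[of "map uminus as"]) auto
qed

section \<open>Positive definite matrices and pencils\<close>

lemma positive_definite_nonneg:
  assumes pd: "positive_definite P" and P: "P \<in> carrier_mat n n" and x: "x \<in> carrier_vec n"
  shows "0 \<le> (P *\<^sub>v x) \<bullet>c x"
proof (cases "x = 0\<^sub>v n")
  case True
  then show ?thesis using P by simp
next
  case False
  then show ?thesis
    using pd x P by (auto simp: positive_definite_def intro: less_imp_le)
qed

lemma positive_definite_det_nonzero:
  assumes "positive_definite P"
  shows "det P \<noteq> 0"
proof
  assume "det P = 0"
  have P: "P \<in> carrier_mat (dim_row P) (dim_row P)"
    using assms by (auto simp: positive_definite_def)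
  obtain v where v: "v \<in> carrier_vec (dim_row P)" "v \<noteq> 0\<^sub>v (dim_row P)" "P *\<^sub>v v = 0\<^sub>v (dim_row P)"
    using \<open>det P = 0\<close> det_0_iff_vec_prod_zero[OF P] by blast
  then have "0 < (P *\<^sub>v v) \<bullet>c v"
    using assms by (auto simp: positive_definite_def)
  then show False using v by simp
qed

lemma positive_definite_inverse:
  assumes "positive_definite P" and P: "P \<in> carrier_mat n n"
  obtains R where "R \<in> carrier_mat n n" and "R * P = 1\<^sub>m n" and "P * R = 1\<^sub>m n"
proof -
  have "P \<in> Units (ring_mat TYPE(complex) n ())"
    using det_non_zero_imp_unit[OF P positive_definite_det_nonzero[OF assms(1)]] .
  then show ?thesis
    using that by (auto simp: Units_def ring_mat_def)
qed

text \<open>The list consists of the eigenvalues of \<open>R * Q\<close>, where \<open>R\<close>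
  inverts \<open>P\<close>. This product need not be Hermitian, but its eigenvectors satisfy
  \<open>Q v = e P v\<close>, and comparing quadratic forms at \<open>v\<close> shows that
  \<open>e\<close> is real and nonnegative.\<close>

lemma positive_pencil_roots:
  assumes pd: "positive_definite P" and P: "P \<in> carrier_mat n n" and Q: "Q \<in> carrier_mat n n"
    and psd: "\<And>v. v \<in> carrier_vec n \<Longrightarrow> 0 \<le> (Q *\<^sub>v v) \<bullet>c v"
  obtains xs where "length xs = n" and "\<And>x. x \<in> set xs \<Longrightarrow> (0::real) \<le> x"
    and "det Q = det P * of_real (prod_list xs)"
    and "det (P + Q) = det P * of_real (\<Prod>x\<leftarrow>xs. 1 + x)"
proof -
  obtain R where R: "R \<in> carrier_mat n n" "R * P = 1\<^sub>m n" "P * R = 1\<^sub>m n"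
    using positive_definite_inverse[OF pd P] .
  have RQ: "R * Q \<in> carrier_mat n n" using R Q by simp
  obtain es where es: "length es = n" "\<And>e. e \<in> set es \<Longrightarrow> eigenvalue (R * Q) e"
    "det (R * Q) = prod_list es" "det (1\<^sub>m n + R * Q) = (\<Prod>e\<leftarrow>es. 1 + e)"
    using det_eigenvalue_list[OF RQ] by blast
  have PRQ: "P * (R * Q) = Q"
    using P Q R by (simp flip: assoc_mult_mat[of P n n R n Q n])
  have nonneg: "0 \<le> e" if e: "e \<in> set es" for e
  proof -
    obtain v where v: "v \<in> carrier_vec n" "v \<noteq> 0\<^sub>v n" "(R * Q) *\<^sub>v v = e \<cdot>\<^sub>v v"
      using es(2)[OF e] RQ by (auto simp: eigenvalue_def eigenvector_def)
    have "Q *\<^sub>v v = P *\<^sub>v ((R * Q) *\<^sub>v v)"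
      using PRQ assoc_mult_mat_vec[OF P RQ v(1)] by simp
    also have "\<dots> = e \<cdot>\<^sub>v (P *\<^sub>v v)"
      using P v by (simp add: mult_mat_vec)
    finally have "(Q *\<^sub>v v) \<bullet>c v = e * ((P *\<^sub>v v) \<bullet>c v)"
      using P v by simp
    moreover have "0 < (P *\<^sub>v v) \<bullet>c v"
      using pd P v by (auto simp: positive_definite_def)
    \<comment> \<open>In the order on complex numbers both facts include realness, so
      \<open>e\<close> is a real quotient with positive denominator.\<close>
    ultimately have "0 \<le> e * ((P *\<^sub>v v) \<bullet>c v)" "0 < (P *\<^sub>v v) \<bullet>c v"
      using psd[OF v(1)] by auto
    then show ?thesis
      by (simp add: less_eq_complex_def less_complex_def zero_le_mult_iff)
  qed
  have es_real: "es = map of_real (map Re es)"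
    using nonneg by (induction es) (auto simp: less_eq_complex_def complex_eq_iff)
  have of_real_prod: "prod_list (map of_real xs) = (of_real (prod_list xs) :: complex)" for xs
    by (induction xs) auto
  have detQ: "det Q = det P * of_real (prod_list (map Re es))"
    using det_mult[OF P RQ] PRQ es(3) es_real of_real_prod by metis
  have "P * (1\<^sub>m n + R * Q) = P + Q"
    using P Q R PRQ by (subst mult_add_distrib_mat[of _ n n _ n]) auto
  then have "det (P + Q) = det P * (\<Prod>e\<leftarrow>es. 1 + e)"
    using det_mult[OF P, of "1\<^sub>m n + R * Q"] RQ es(4) by simp
  also have "(\<Prod>e\<leftarrow>es. 1 + e) = of_real (\<Prod>x\<leftarrow>map Re es. 1 + x)"
    by (subst es_real, subst of_real_prod[symmetric]) (simp add: o_def)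
  finally have detPQ: "det (P + Q) = det P * of_real (\<Prod>x\<leftarrow>map Re es. 1 + x)" .
  show ?thesis
    using es(1) nonneg detQ detPQ by (intro that[of "map Re es"]) (auto simp: less_eq_complex_def)
qed

lemma positive_definite_one: "positive_definite (1\<^sub>m n)"
  by (auto simp: positive_definite_def)

text \<open>Apply the pencil lemma to the identity and \<open>P\<close>: the determinant is a
  product of nonnegative reals, and it is nonzero.\<close>

lemma positive_definite_det_pos:
  assumes pd: "positive_definite P"
  shows "0 < Re (det P)"
proof -
  obtain n where P: "P \<in> carrier_mat n n"
    using pd by (auto simp: positive_definite_def)
  obtain xs where xs: "\<And>x. x \<in> set xs \<Longrightarrow> (0::real) \<le> x"
    and det: "det P = det (1\<^sub>m n) * of_real (prod_list xs)"
    using positive_pencil_roots[OF positive_definite_one one_carrier_mat P positive_definite_nonneg[OF pd P]]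
    by blast
  have "0 \<le> prod_list xs"
    using xs by (intro prod_list_nonneg) auto
  moreover have "prod_list xs \<noteq> 0"
    using positive_definite_det_nonzero[OF pd] det by auto
  ultimately have "0 < prod_list xs" by linarith
  then show ?thesis by (simp add: det)
qed

text \<open>Substituting \<open>y = P x\<close> turns the form of the inverse at \<open>y\<close>
  into the form of \<open>P\<close> at \<open>x\<close>, since \<open>P\<close> is
  self-adjoint.\<close>

lemma positive_definite_inverse_nonneg:
  assumes pd: "positive_definite P" and P: "P \<in> carrier_mat n n" and R: "R \<in> carrier_mat n n"
    and PR: "P * R = 1\<^sub>m n" and y: "y \<in> carrier_vec n"
  shows "0 \<le> (R *\<^sub>v y) \<bullet>c y"
proof -
  define x where "x = R *\<^sub>v y"
  have x: "x \<in> carrier_vec n" using R y by (simp add: x_def)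
  have Px: "P *\<^sub>v x = y"
    using P R PR y by (simp add: x_def flip: assoc_mult_mat_vec[of P n n R n])
  have "x \<bullet>c (P *\<^sub>v x) = (P *\<^sub>v x) \<bullet>c x"
    using cscalar_prod_mat_adjoint[OF P x x] pd by (simp add: positive_definite_def)
  then show ?thesis
    using positive_definite_nonneg[OF pd P x] by (simp add: x_def[symmetric] Px)
qed

section \<open>Hua's matrix identity\<close>

text \<open>With a single dimension \<open>n\<close> no inner dimension has to be guessed, which
  makes these usable as simplification rules.\<close>

lemma square_mult_closed:
  fixes X Y :: "'a::semiring_0 mat"
  assumes "X \<in> carrier_mat n n"
  shows "Y \<in> carrier_mat n n \<Longrightarrow> X * Y \<in> carrier_mat n n"
    and "v \<in> carrier_vec n \<Longrightarrow> X *\<^sub>v v \<in> carrier_vec n"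
  using assms by (auto intro: mult_carrier_mat mult_mat_vec_carrier)

text \<open>With \<open>D = A - B\<close>, the outer factors on the right are
  \<open>C + D' * A\<close> and \<open>C + A' * D\<close>. Expanding around \<open>R\<close>, the
  inverse of \<open>C\<close>, leaves only one term containing \<open>R\<close>, and the left side
  has the same term.\<close>

lemma hua_identity:
  fixes A B :: "complex mat"
  assumes A: "A \<in> carrier_mat n n" and B: "B \<in> carrier_mat n n" and R: "R \<in> carrier_mat n n"
    and RC: "R * (1\<^sub>m n - mat_adjoint A * A) = 1\<^sub>m n"
    and CR: "(1\<^sub>m n - mat_adjoint A * A) * R = 1\<^sub>m n"
  shows "(1\<^sub>m n - mat_adjoint B * B)
      + mat_adjoint (A - B) * (1\<^sub>m n + A * R * mat_adjoint A) * (A - B)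
    = (1\<^sub>m n - mat_adjoint B * A) * (R * (1\<^sub>m n - mat_adjoint A * B))"
proof -
  note square_mult_closed [simp] minus_carrier_mat [simp]
  define A' B' C D D' where defs: "A' = mat_adjoint A" "B' = mat_adjoint B"
    "C = 1\<^sub>m n - A' * A" "D = A - B" "D' = A' - B'"
  have A': "A' \<in> carrier_mat n n" and B': "B' \<in> carrier_mat n n" and C: "C \<in> carrier_mat n n"
    and D: "D \<in> carrier_mat n n" and D': "D' \<in> carrier_mat n n"
    unfolding defs using A B
    by (auto intro!: minus_carrier_mat)
  have adj: "mat_adjoint (A - B) = D'"
    using A B by (simp add: defs mat_adjoint_minus)
  have F: "1\<^sub>m n - A' * B = C + A' * D"
    unfolding defs(3,4) mult_minus_distrib_mat[OF A' A B]
    using A B A' by (intro eq_matI) auto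
  have E: "1\<^sub>m n - B' * A = C + D' * A"
    unfolding defs(3,5) minus_mult_distrib_mat[OF A' B' A]
    using A B' A' by (intro eq_matI) auto
  \<comment> \<open>The one term in which \<open>R\<close> does not cancel against
    \<open>C\<close>.\<close>
  define X where "X = (D' * A) * (R * (A' * D))"
  have X: "X \<in> carrier_mat n n"
    using D' A R A' D by (simp add: X_def)
  have CRF: "C * (R * (A' * D)) = A' * D"
    using assoc_mult_mat[OF C R, of "A' * D" n] CR A' D
      left_mult_one_mat[of "A' * D" n n] by (simp add: defs(1,3))
  have "R * (C + A' * D) = 1\<^sub>m n + R * (A' * D)"
    using mult_add_distrib_mat[OF R C, of "A' * D"] RC A' D by (simp add: defs(1,3))
  then have "(C + D' * A) * (R * (C + A' * D)) = (C + D' * A) * (1\<^sub>m n + R * (A' * D))"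
    by simp
  also have "\<dots> = C * (1\<^sub>m n + R * (A' * D)) + (D' * A) * (1\<^sub>m n + R * (A' * D))"
    using C D' A R A' D by (intro add_mult_distrib_mat[of _ n n _ _ n]) auto
  also have "C * (1\<^sub>m n + R * (A' * D)) = C + A' * D"
    using mult_add_distrib_mat[OF C, of "1\<^sub>m n" n "R * (A' * D)"] CRF C R A' D by simp
  also have "(D' * A) * (1\<^sub>m n + R * (A' * D)) = D' * A + X"
    using mult_add_distrib_mat[of "D' * A" n n "1\<^sub>m n" n "R * (A' * D)"] C R A' D D' A
    by (simp add: X_def del: assoc_mult_mat)
  finally have rhs: "(1\<^sub>m n - B' * A) * (R * (1\<^sub>m n - A' * B)) = C + A' * D + (D' * A + X)"
    unfolding E F .
  have "D' * (1\<^sub>m n + A * R * A') * D = (D' + D' * (A * R * A')) * D"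
    using mult_add_distrib_mat[OF D', of "1\<^sub>m n" n "A * R * A'"] D' A R A' by simp
  also have "\<dots> = D' * D + D' * (A * R * A') * D"
    using D' A R A' D by (intro add_mult_distrib_mat[of _ n n]) auto
  also have "D' * (A * R * A') * D = X"
    using D' A R A' D by (simp add: X_def assoc_mult_mat[of _ n n _ n _ n])
  finally have lhs: "D' * (1\<^sub>m n + A * R * A') * D = D' * D + X" .
  have "D' * D = (A' * A - A' * B) - (B' * A - B' * B)"
    unfolding defs(4,5) minus_mult_distrib_mat[OF A' B' D[unfolded defs(4)]]
      mult_minus_distrib_mat[OF A' A B] mult_minus_distrib_mat[OF B' A B] ..
  \<comment> \<open>Once \<open>D\<close> and \<open>D'\<close> are expanded, this is linear in the
    products of \<open>A'\<close>, \<open>B'\<close> with \<open>A\<close>, \<open>B\<close>; their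
    entries are kept unexpanded.\<close>
  then have "(1\<^sub>m n - B' * B) + (D' * D + X) = C + A' * D + (D' * A + X)"
    unfolding defs(3) defs(4) defs(5) mult_minus_distrib_mat[OF A' A B]
      minus_mult_distrib_mat[OF A' B' A]
    using A B A' B' X
    by (intro eq_matI) (auto simp del: index_mult_mat(1))
  then show ?thesis
    using rhs lhs unfolding adj unfolding defs(1,2,4)[symmetric] by simp
qed

section \<open>From the matrix identity to the scalar inequality\<close>

theorem corollary4p1:
  fixes n :: nat and A B :: "complex mat"
  assumes "n > 0"
    and "strictly_contractive n A"
    and "strictly_contractive n B"
  shows "(cmod (det (1\<^sub>m n - mat_adjoint A * B)))\<^sup>2 \<ge>
      Re (det (1\<^sub>m n - mat_adjoint A * A)) * Re (det (1\<^sub>m n - mat_adjoint B * B))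
      + (cmod (det (A - B)))\<^sup>2
      + (2 ^ n - 2) *
        sqrt (Re (det (1\<^sub>m n - mat_adjoint A * A)) * Re (det (1\<^sub>m n - mat_adjoint B * B))) *
        cmod (det (A - B))"
proof -
  note square_mult_closed [simp] minus_carrier_mat [simp]
  define C where "C = 1\<^sub>m n - mat_adjoint A * A"
  define P where "P = 1\<^sub>m n - mat_adjoint B * B"
  define D where "D = A - B"
  have A: "A \<in> carrier_mat n n" and B: "B \<in> carrier_mat n n"
    and pdC: "positive_definite C" and pdP: "positive_definite P"
    using assms by (auto simp: strictly_contractive_def C_def P_def)
  have C: "C \<in> carrier_mat n n" and P: "P \<in> carrier_mat n n" and D: "D \<in> carrier_mat n n"
    unfolding C_def P_def D_def using A B
    by (auto intro!: minus_carrier_mat)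
  obtain R where R: "R \<in> carrier_mat n n" and RC: "R * C = 1\<^sub>m n" and CR: "C * R = 1\<^sub>m n"
    using positive_definite_inverse[OF pdC C] .
  \<comment> \<open>The middle factor in Hua's identity, equal to the inverse of
    \<open>1\<^sub>m n - A * mat_adjoint A\<close>. In this form its quadratic form at
    \<open>w\<close> is visibly a squared norm plus the form of \<open>R\<close> at
    \<open>mat_adjoint A *\<^sub>v w\<close>.\<close>
  define W where "W = 1\<^sub>m n + A * R * mat_adjoint A"
  define Q where "Q = mat_adjoint D * W * D"
  have W: "W \<in> carrier_mat n n" and Q: "Q \<in> carrier_mat n n"
    using A R D by (auto simp: W_def Q_def)
  have W_nonneg: "0 \<le> (W *\<^sub>v w) \<bullet>c w" if w: "w \<in> carrier_vec n" for w
  proof -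
    define y where "y = mat_adjoint A *\<^sub>v w"
    have y: "y \<in> carrier_vec n"
      using A w by (simp add: y_def)
    have "W *\<^sub>v w = w + A *\<^sub>v (R *\<^sub>v y)"
      using A R w
      by (simp add: W_def y_def add_mult_distrib_mat_vec[of _ n n] assoc_mult_mat_vec[of _ n n _ n])
    moreover have "(A *\<^sub>v (R *\<^sub>v y)) \<bullet>c w = (R *\<^sub>v y) \<bullet>c y"
      using cscalar_prod_mat_adjoint[OF A _ w, of "R *\<^sub>v y"] R y by (simp add: y_def)
    ultimately have "(W *\<^sub>v w) \<bullet>c w = w \<bullet>c w + (R *\<^sub>v y) \<bullet>c y"
      using A R w y by (simp add: add_scalar_prod_distrib[of _ n])
    then show ?thesis
      using positive_definite_inverse_nonneg[OF pdC C R CR y] conjugate_square_ge_0_vec[of w] by simp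
  qed
  have psd: "0 \<le> (Q *\<^sub>v v) \<bullet>c v" if v: "v \<in> carrier_vec n" for v
  proof -
    have "Q *\<^sub>v v = mat_adjoint D *\<^sub>v (W *\<^sub>v (D *\<^sub>v v))"
      using D W v by (simp add: Q_def assoc_mult_mat_vec[of _ n n _ n])
    then have "(Q *\<^sub>v v) \<bullet>c v = (W *\<^sub>v (D *\<^sub>v v)) \<bullet>c (D *\<^sub>v v)"
      using cscalar_prod_mat_adjoint[of "mat_adjoint D" n n "W *\<^sub>v (D *\<^sub>v v)" v] D W v by simp
    then show ?thesis using W_nonneg[of "D *\<^sub>v v"] D v by simp
  qed
  obtain xs where xs: "length xs = n" "\<And>x. x \<in> set xs \<Longrightarrow> (0::real) \<le> x"
    and detQ: "det Q = det P * of_real (prod_list xs)"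
    and detPQ: "det (P + Q) = det P * of_real (\<Prod>x\<leftarrow>xs. 1 + x)"
    using positive_pencil_roots[OF pdP P Q psd] by blast
  \<comment> \<open>In these scalars the claim reads
    \<open>z^2 \<ge> c * p + d^2 + (2 ^ n - 2) * sqrt (c * p) * d\<close>.\<close>
  define c p where "c = Re (det C)" and "p = Re (det P)"
  define d z where "d = cmod (det D)" and "z = cmod (det (1\<^sub>m n - mat_adjoint A * B))"
  define q t where "q = prod_list xs" and "t = (\<Prod>x\<leftarrow>xs. 1 + x)"
  have c: "det C = of_real c" "0 < c" and p: "det P = of_real p" "0 < p"
    using det_positive_definite_real positive_definite_det_pos pdC pdP by (auto simp: c_def p_def)
  have RC_det: "det R * det C = 1"
    using det_mult[OF R C] RC by simp
  \<comment> \<open>Sylvester's identity moves the left factor \<open>A\<close> to the right end,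
    and \<open>R * C = 1\<^sub>m n\<close> collapses the result to \<open>R\<close>. Hence
    \<open>det Q * det C\<close> is the squared modulus of \<open>det D\<close>.\<close>
  have "det W = det R"
  proof -
    have "det W = det (1\<^sub>m n + A * (R * mat_adjoint A))"
      using A R by (simp add: W_def assoc_mult_mat[of _ n n _ n _ n])
    also have "\<dots> = det (1\<^sub>m n + R * mat_adjoint A * A)"
      using A R by (intro det_one_plus_mult_commute) auto
    also have "1\<^sub>m n + R * mat_adjoint A * A = R"
    proof -
      have "R - R * mat_adjoint A * A = 1\<^sub>m n"
        using RC A R mult_minus_distrib_mat[OF R, of "1\<^sub>m n" n "mat_adjoint A * A"]
          assoc_mult_mat[OF R mat_adjoint_carrier[OF A] A]
        by (simp add: C_def)
      then show ?thesis
        using A R by (intro eq_matI) (auto simp flip: \<open>R - R * mat_adjoint A * A = 1\<^sub>m n\<close>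
            simp del: index_mult_mat(1))
    qed
    finally show ?thesis .
  qed
  then have "det Q = det R * (cnj (det D) * det D)"
    using D W by (simp add: Q_def det_mult[of _ n] det_mat_adjoint ac_simps)
  then have "det Q * det C = of_real (d\<^sup>2)"
    using RC_det complex_norm_square[of "det D"] by (simp add: d_def ac_simps)
  then have "complex_of_real (p * q * c) = of_real (d\<^sup>2)"
    using detQ c p by (simp add: q_def)
  then have d2: "d\<^sup>2 = p * c * q"
    unfolding of_real_eq_iff by (simp add: ac_simps)
  \<comment> \<open>The outer factors in Hua's identity are adjoint to each other, so their
    determinants multiply to \<open>z^2\<close>.\<close>
  have "mat_adjoint (1\<^sub>m n - mat_adjoint A * B) = 1\<^sub>m n - mat_adjoint B * A"
    using A B by (simp add: mat_adjoint_minus[of _ n n] mat_adjoint_mult[of _ n n _ n])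
  then have adj: "det (1\<^sub>m n - mat_adjoint B * A) = cnj (det (1\<^sub>m n - mat_adjoint A * B))"
    using A B det_mat_adjoint[of "1\<^sub>m n - mat_adjoint A * B" n] by simp
  have "P + Q = (1\<^sub>m n - mat_adjoint B * A) * (R * (1\<^sub>m n - mat_adjoint A * B))"
    unfolding P_def Q_def W_def D_def
    using hua_identity[OF A B R] RC CR by (simp add: C_def)
  then have "det (P + Q) = cnj (det (1\<^sub>m n - mat_adjoint A * B)) * (det R * det (1\<^sub>m n - mat_adjoint A * B))"
    using A B R by (simp add: det_mult[of _ n] adj)
  then have "det (P + Q) * det C = of_real (z\<^sup>2)"
    using RC_det complex_norm_square[of "det (1\<^sub>m n - mat_adjoint A * B)"] by (simp add: z_def ac_simps)
  then have "complex_of_real (p * t * c) = of_real (z\<^sup>2)"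
    using detPQ c p by (simp add: t_def)
  then have z2: "z\<^sup>2 = p * c * t"
    unfolding of_real_eq_iff by (simp add: ac_simps)
  \<comment> \<open>Taking the root of \<open>d^2 = p * c * q\<close> identifies the mixed term of
    the claim with \<open>p * c\<close> times the root term of the scalar bound.\<close>
  have "0 \<le> d" by (simp add: d_def)
  then have "d = sqrt (p * c * q)"
    using d2 by (metis real_sqrt_abs abs_of_nonneg)
  then have "d = sqrt (c * p) * sqrt q"
    by (simp add: real_sqrt_mult ac_simps)
  then have sqrt_d: "sqrt (c * p) * d = p * c * sqrt q"
    using c p by (simp add: mult.assoc[symmetric])
  have "1 + q + (2 ^ n - 2) * sqrt q \<le> t"
    using prod_list_one_plus_ge[of xs] xs \<open>n > 0\<close> by (auto simp: q_def t_def)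
  then have "p * c * (1 + q + (2 ^ n - 2) * sqrt q) \<le> p * c * t"
    using c p by (intro mult_left_mono) auto
  also have "p * c * (1 + q + (2 ^ n - 2) * sqrt q) = c * p + d\<^sup>2 + (2 ^ n - 2) * (sqrt (c * p) * d)"
    unfolding sqrt_d d2 by (simp add: algebra_simps)
  finally show ?thesis
    unfolding z2[symmetric] by (simp add: c_def p_def d_def z_def C_def P_def D_def mult.assoc)
qed

end
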